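(* Let $Q$ be a quiver with no self-loops or $2$-cycles whose vertices $v$ are decorated with integer labels $w_v$, and suppose $Q$ is balanced with respect to these labels. Let $w(Q)=\gcd\{w_v\mid v\in\mathrm{verts}(Q)\}$. For any vertex $m$ of $Q$ we have $w(Q)=w(\mathrm{mut}_m(Q))$.
   Context: All quivers have finitely many vertices and finitely many arrows between any two vertices. For vertices $x,y$ of a quiver without self-loops or $2$-cycles, $\mathrm{a}(x,y)$ is the signed number of arrows between them: positive if arrows point from $x$ to $y$, negative if from $y$ to $x$, zero if there are none. $\mathrm{out}(m)$ is the set of vertices receiving an arrow from $m$, and $\mathrm{in}(m)$ is the set of vertices from which $m$ receives an arrow. $Q$ is balanced with respect to the labels $w_v$ if for every vertex $m$, $\sum_{h\in\mathrm{out}(m)}w_h\,\mathrm{a}(m,h)=\sum_{t\in\mathrm{in}(m)}w_t\,\mathrm{a}(t,m)$; the common value is the diameter $D(m)$. The underlying quiver of $\mathrm{mut}_m(Q)$ is the usual quiver mutation at $m$: for every path $t\to m\to h$ add an arrow $t\to h$; reverse all arrows incident at $m$; cancel all $2$-cycles. Each vertex $v\ne m$ keeps its label, and $m$ receives the label $D(m)-w_m$. The gcd is taken to be non-negative, and is $0$ if all labels vanish. *)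

theory Defs
  imports Main
begin

(* A quiver is recorded by its vertex set and, for each ordered pair of vertices, the
   number of arrows from the first to the second.  Arrows are thus not named; a multiplicity in
   nat builds in that there are only finitely many arrows between two vertices. *)
record 'v quiver =
  verts :: "'v set"
  narrows :: "'v \<Rightarrow> 'v \<Rightarrow> nat"

record 'v labelled_quiver = "'v quiver" +
  label :: "'v \<Rightarrow> int"

definition is_quiver :: "('v, 'z) quiver_scheme \<Rightarrow> bool" where
  "is_quiver Q \<longleftrightarrow> finite (verts Q) \<and>
    (\<forall>x y. narrows Q x y > 0 \<longrightarrow> x \<in> verts Q \<and> y \<in> verts Q)"

definition no_self_loops :: "('v, 'z) quiver_scheme \<Rightarrow> bool" where
  "no_self_loops Q \<longleftrightarrow> (\<forall>x \<in> verts Q. narrows Q x x = 0)"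

definition no_two_cycles :: "('v, 'z) quiver_scheme \<Rightarrow> bool" where
  "no_two_cycles Q \<longleftrightarrow>
    (\<forall>x \<in> verts Q. \<forall>y \<in> verts Q. x \<noteq> y \<longrightarrow> \<not> (narrows Q x y > 0 \<and> narrows Q y x > 0))"

definition signed_arrows :: "('v, 'z) quiver_scheme \<Rightarrow> 'v \<Rightarrow> 'v \<Rightarrow> int" where
  "signed_arrows Q x y = int (narrows Q x y) - int (narrows Q y x)"

definition out_verts :: "('v, 'z) quiver_scheme \<Rightarrow> 'v \<Rightarrow> 'v set" where
  "out_verts Q m = {h \<in> verts Q. narrows Q m h > 0}"

definition in_verts :: "('v, 'z) quiver_scheme \<Rightarrow> 'v \<Rightarrow> 'v set" where
  "in_verts Q m = {t \<in> verts Q. narrows Q t m > 0}"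

definition balanced :: "'v labelled_quiver \<Rightarrow> bool" where
  "balanced Q \<longleftrightarrow> (\<forall>m \<in> verts Q.
    (\<Sum>h \<in> out_verts Q m. label Q h * signed_arrows Q m h)
      = (\<Sum>t \<in> in_verts Q m. label Q t * signed_arrows Q t m))"

(* Only meaningful for balanced quivers, where the sum over in_verts gives the same value. *)
definition diameter :: "'v labelled_quiver \<Rightarrow> 'v \<Rightarrow> int" where
  "diameter Q m = (\<Sum>h \<in> out_verts Q m. label Q h * signed_arrows Q m h)"

(* There are narrows Q t m * narrows Q m h paths t -> m -> h. *)
definition add_composites :: "'v \<Rightarrow> ('v, 'z) quiver_scheme \<Rightarrow> ('v, 'z) quiver_scheme" where
  "add_composites m Q =
    Q\<lparr>narrows := \<lambda>t h. narrows Q t h + narrows Q t m * narrows Q m h\<rparr>"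

definition reverse_at :: "'v \<Rightarrow> ('v, 'z) quiver_scheme \<Rightarrow> ('v, 'z) quiver_scheme" where
  "reverse_at m Q =
    Q\<lparr>narrows := \<lambda>x y. if x = m \<or> y = m then narrows Q y x else narrows Q x y\<rparr>"

(* Pairs of opposite arrows are deleted until none is left, so the truncated subtraction on
   nat is intended; loops are not 2-cycles and are left alone. *)
definition cancel_two_cycles :: "('v, 'z) quiver_scheme \<Rightarrow> ('v, 'z) quiver_scheme" where
  "cancel_two_cycles Q =
    Q\<lparr>narrows := \<lambda>x y. if x = y then narrows Q x y else narrows Q x y - narrows Q y x\<rparr>"

definition mut_quiver :: "'v \<Rightarrow> ('v, 'z) quiver_scheme \<Rightarrow> ('v, 'z) quiver_scheme" where
  "mut_quiver m Q = cancel_two_cycles (reverse_at m (add_composites m Q))"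

definition mut :: "'v \<Rightarrow> 'v labelled_quiver \<Rightarrow> 'v labelled_quiver" where
  "mut m Q = (mut_quiver m Q)\<lparr>label := (label Q)(m := diameter Q m - label Q m)\<rparr>"

definition label_gcd :: "'v labelled_quiver \<Rightarrow> int" where
  "label_gcd Q = Gcd (label Q ` verts Q)"

end

theory Submission
  imports Defs
begin

text \<open>Since there is no loop at \<open>m\<close>, \<open>D(m)\<close> is an integer combination of the labels of vertices
  other than \<open>m\<close>, so it is divisible by their gcd \<open>g\<close>; hence
  \<open>gcd(D(m) - w\<^sub>m, g) = gcd(w\<^sub>m, g)\<close>.\<close>

lemma verts_mut [simp]: "verts (mut m Q) = verts Q"
  by (simp add: mut_def mut_quiver_def cancel_two_cycles_def reverse_at_def add_composites_def)

lemma label_mut [simp]: "label (mut m Q) = (label Q)(m := diameter Q m - label Q m)"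
  by (simp add: mut_def)

text \<open>Mutation at \<open>m\<close> changes no label but that of \<open>m\<close>, so this
  separates the changing label from a gcd shared by \<open>Q\<close> and
  \<open>mut m Q\<close>.\<close>

lemma label_gcd_split:
  assumes "m \<in> verts Q"
  shows "label_gcd Q = gcd (label Q m) (Gcd (label Q ` (verts Q - {m})))"
proof -
  have "label Q ` verts Q = insert (label Q m) (label Q ` (verts Q - {m}))"
    using assms by auto
  then show ?thesis
    by (simp add: label_gcd_def)
qed

lemma Gcd_other_labels_dvd_diameter:
  assumes "no_self_loops Q"
  shows "Gcd (label Q ` (verts Q - {m})) dvd diameter Q m"
  unfolding diameter_def
proof (rule dvd_sum)
  fix h assume "h \<in> out_verts Q m"
  \<comment> \<open>\<open>h = m\<close> would require a loop at \<open>m\<close>.\<close>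
  with assms have "h \<in> verts Q - {m}"
    by (auto simp: out_verts_def no_self_loops_def)
  then show "Gcd (label Q ` (verts Q - {m})) dvd label Q h * signed_arrows Q m h"
    by (intro dvd_mult2 Gcd_dvd) simp
qed

text \<open>Modulo \<open>g\<close> the term \<open>b\<close> vanishes, and a gcd with
  \<open>g\<close> depends only on the residue modulo \<open>g\<close>, up to sign.\<close>

lemma gcd_diff_left_of_dvd:
  fixes a b g :: int
  assumes "g dvd b"
  shows "gcd (b - a) g = gcd a g"
proof -
  have "(b - a) mod g = (- a) mod g"
    using assms by (simp add: mod_eq_dvd_iff)
  then show ?thesis
    by (metis gcd.commute gcd_neg1_int gcd_red_int)
qed

theorem proposition4p12:
  fixes Q :: "'v labelled_quiver" and m :: 'v
  assumes "is_quiver Q" and "no_self_loops Q" and "no_two_cycles Q"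
    and "balanced Q"
    and "m \<in> verts Q"
  shows "label_gcd Q = label_gcd (mut m Q)"
proof -
  \<comment> \<open>Makes the second gcd argument the same before and after mutation.\<close>
  have "label (mut m Q) ` (verts Q - {m}) = label Q ` (verts Q - {m})"
    by auto
  then have "label_gcd (mut m Q)
      = gcd (diameter Q m - label Q m) (Gcd (label Q ` (verts Q - {m})))"
    using assms(5) by (simp add: label_gcd_split[of m])
  also have "\<dots> = gcd (label Q m) (Gcd (label Q ` (verts Q - {m})))"
    using Gcd_other_labels_dvd_diameter[OF assms(2)] by (rule gcd_diff_left_of_dvd)
  also have "\<dots> = label_gcd Q"
    using assms(5) by (simp add: label_gcd_split)
  finally show ?thesis ..
qed

end
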